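(* Suppose $(A_d,G_d)$ is reachable and $(C,A_d)$ is observable. Suppose $A$ has exactly $r'$ Hurwitz-unstable eigenvalues, i.e. eigenvalues with nonnegative real part, counted with multiplicity. Let $r\in\{1,\dots,n-1\}$ satisfy $\mathrm{Re}\,\lambda_r(A)>\mathrm{Re}\,\lambda_{r+1}(A)$, let $\bar U\in\mathcal{U}$, and let $\tilde F\in\mathbb{R}^{r\times p}$ be the steady-state low-rank Kalman gain. Then $A_d(I_n-\bar U\tilde FC)$ is Schur stable if and only if $r\ge r'$.
   Context: Let $A\in\mathbb{R}^{n\times n}$ have eigenvalues $\lambda_1(A),\dots,\lambda_n(A)$, ordered so that $\mathrm{Re}\,\lambda_1(A)\ge\dots\ge\mathrm{Re}\,\lambda_n(A)$, with unit-norm (generalized) eigenvectors $\psi_i(A)$. Let $\mathrm{St}(r,n)=\{X\in\mathbb{R}^{n\times r}:X^{\top}X=I_r\}$ and $$\mathcal{U}=\{(\psi_1(A),\dots,\psi_r(A))K\in\mathrm{St}(r,n):K\in\mathbb{C}^{r\times r}\}.$$ These are the real orthonormal-column matrices whose column space is the $A$-invariant subspace spanned by $\psi_1(A),\dots,\psi_r(A)$; they are the stable equilibria of the Oja flow $\varepsilon\dot U=(I_n-UU^{\top})AU$, and satisfy $(I_n-\bar U\bar U^{\top})A\bar U=0$. Let $h>0$, $A_d=e^{Ah}$, $G\in\mathbb{R}^{n\times q}$ and $$G_d=\sqrt{\int_0^h e^{A\tau}GG^{\top}e^{A^{\top}\tau}d\tau}$$ (positive semidefinite square root). Let $C\in\mathbb{R}^{p\times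 n}$ and $H\in\mathbb{R}^{p\times p}$ with $\det H\neq0$, and set $M=HH^{\top}$. Define $A_{\bar U}=\bar U^{\top}A_d\bar U$, $G_{\bar U}=\bar U^{\top}G_d$ and $C_{\bar U}=C\bar U$. The steady-state low-rank Kalman gain is $$\tilde F=\tilde RC_{\bar U}^{\top}(C_{\bar U}\tilde RC_{\bar U}^{\top}+M)^{-1},$$ where $\tilde R\in\mathbb{R}^{r\times r}$ is the unique positive definite solution of $$\tilde R=A_{\bar U}(\tilde R-\tilde FC_{\bar U}\tilde R)A_{\bar U}^{\top}+G_{\bar U}G_{\bar U}^{\top}.$$ A triple $(A_d,G_d,C)$ is called reachable and observable when $(A_d,G_d)$ is reachable and $(C,A_d)$ is observable. A square matrix is Schur stable if all its eigenvalues have modulus $<1$. *)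

theory Defs
  imports "HOL-Analysis.Analysis"
begin

(* matrix power *)
definition mpow :: "'a::comm_ring_1^'n^'n \<Rightarrow> nat \<Rightarrow> 'a^'n^'n" where
  "mpow M k = (((**) M) ^^ k) (mat 1)"

(* matrix exponential e^M as its power series *)
definition mexp :: "real^'n^'n \<Rightarrow> real^'n^'n" where
  "mexp M = (\<Sum>k. (1 / fact k) *\<^sub>R mpow M k)"

(* complexification of a real matrix *)
definition cmat :: "real^'n^'m \<Rightarrow> complex^'n^'m" where
  "cmat M = (\<chi> i j. complex_of_real (M $ i $ j))"

(* characteristic polynomial det(z I - M) evaluated at z *)
definition charpoly_at :: "real^'n^'n \<Rightarrow> complex \<Rightarrow> complex" where
  "charpoly_at M z = det ((\<chi> i j. if i = j then z else 0) - cmat M)"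

(* ls is the list of all eigenvalues of M, counted with algebraic multiplicity,
   ordered by non-increasing real part *)
definition ordered_eigenvalues :: "real^'n^'n \<Rightarrow> complex list \<Rightarrow> bool" where
  "ordered_eigenvalues M ls \<longleftrightarrow>
     length ls = CARD('n) \<and>
     sorted_wrt (\<lambda>a b. Re a \<ge> Re b) ls \<and>
     (\<forall>z. charpoly_at M z = (\<Prod>\<mu>\<leftarrow>ls. z - \<mu>))"

(* Schur stability: all eigenvalues strictly inside the unit disc *)
definition schur_stable :: "real^'n^'n \<Rightarrow> bool" where
  "schur_stable M \<longleftrightarrow> (\<forall>z. charpoly_at M z = 0 \<longrightarrow> cmod z < 1)"

definition psd :: "real^'n^'n \<Rightarrow> bool" where
  "psd S \<longleftrightarrow> transpose S = S \<and> (\<forall>x. 0 \<le> x \<bullet> (S *v x))"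

definition pd :: "real^'n^'n \<Rightarrow> bool" where
  "pd S \<longleftrightarrow> transpose S = S \<and> (\<forall>x. x \<noteq> 0 \<longrightarrow> 0 < x \<bullet> (S *v x))"

(* positive semidefinite square root *)
definition psd_sqrt :: "real^'n^'n \<Rightarrow> real^'n^'n" where
  "psd_sqrt W = (THE S. psd S \<and> S ** S = W)"

(* (A,B) reachable: the reachable subspace span{A^k B v} is the whole space *)
definition reachable :: "real^'n^'n \<Rightarrow> real^'q^'n \<Rightarrow> bool" where
  "reachable A B \<longleftrightarrow>
     span (\<Union>k\<in>{..<CARD('n)}. range (\<lambda>v. (mpow A k ** B) *v v)) = UNIV"

(* (C,A) observable: the unobservable subspace is trivial *)
definition observable :: "real^'n^'p \<Rightarrow> real^'n^'n \<Rightarrow> bool" where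
  "observable C A \<longleftrightarrow>
     (\<forall>x. (\<forall>k<CARD('n). (C ** mpow A k) *v x = 0) \<longrightarrow> x = 0)"

(* generalized eigenspace of M for the eigenvalue mu (complex) *)
definition gen_eigenspace :: "real^'n^'n \<Rightarrow> complex \<Rightarrow> (complex^'n) set" where
  "gen_eigenspace M \<mu> =
     {v. mpow (cmat M - (\<chi> i j. if i = j then \<mu> else 0)) CARD('n) *v v = 0}"

(* span of the (generalized) eigenvectors psi_1..psi_r, ls the ordered eigenvalue list *)
definition top_invariant_subspace :: "real^'n^'n \<Rightarrow> complex list \<Rightarrow> nat \<Rightarrow> (complex^'n) set" where
  "top_invariant_subspace M ls r =
     {x. \<exists>f. (\<forall>\<mu>\<in>set (take r ls). f \<mu> \<in> gen_eigenspace M \<mu>) \<and>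
             x = (\<Sum>\<mu>\<in>set (take r ls). f \<mu>)}"

(* the set \<U>: real orthonormal-column n x r matrices U = Psi K, i.e. whose
   complex column space equals span{psi_1,...,psi_r} *)
definition U_set :: "real^'n^'n \<Rightarrow> complex list \<Rightarrow> (real^'r^'n) set" where
  "U_set M ls =
     {U. transpose U ** U = mat 1 \<and>
         range (\<lambda>k. cmat U *v k) = top_invariant_subspace M ls CARD('r)}"

(* sampled-data discretisation: A_d = e^{Ah}, G_d = sqrt(int_0^h e^{A t} G G^T e^{A^T t} dt) *)
definition disc_A :: "real \<Rightarrow> real^'n^'n \<Rightarrow> real^'n^'n" where
  "disc_A h A = mexp (h *\<^sub>R A)"

definition disc_G :: "real \<Rightarrow> real^'n^'n \<Rightarrow> real^'q^'n \<Rightarrow> real^'n^'n" where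
  "disc_G h A G = psd_sqrt (integral {0..h}
      (\<lambda>\<tau>. mexp (\<tau> *\<^sub>R A) ** G ** transpose G ** transpose (mexp (\<tau> *\<^sub>R A))))"

(* Kalman gain F = R C^T (C R C^T + M)^{-1} *)
definition kalman_gain :: "real^'r^'p \<Rightarrow> real^'p^'p \<Rightarrow> real^'r^'r \<Rightarrow> real^'p^'r" where
  "kalman_gain Cr M R = R ** transpose Cr ** matrix_inv (Cr ** R ** transpose Cr + M)"

(* discrete algebraic Riccati equation R = A (R - F C R) A^T + G G^T *)
definition dare :: "real^'r^'r \<Rightarrow> real^'m^'r \<Rightarrow> real^'r^'p \<Rightarrow> real^'p^'p \<Rightarrow> real^'r^'r \<Rightarrow> bool" where
  "dare Ar Gr Cr M R \<longleftrightarrow>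
     R = Ar ** (R - kalman_gain Cr M R ** Cr ** R) ** transpose Ar + Gr ** transpose Gr"

end

theory Submission
  imports Defs "HOL-Computational_Algebra.Fundamental_Theorem_Algebra"
begin

declare transpose_matrix_vector [simp del]

text \<open>
  Let \<open>N\<close> be the space of complex vectors annihilated by \<open>U\<^sup>T\<close>, and write \<open>K\<close> for the
  matrix of the theorem. As \<open>A\<^sub>d U = U A\<^sub>U\<close>, the transpose of \<open>K\<close> agrees with that of \<open>A\<^sub>d\<close> on
  the invariant subspace \<open>N\<close>, and \<open>U\<^sup>T\<close> maps its remaining eigenvectors to eigenvectors of the
  transpose of \<open>A\<^sub>U (I - F C\<^sub>U)\<close>. The latter is Schur stable because \<open>R\<close> is positive definite and
  \<open>(C, A\<^sub>d)\<close> is observable. On \<open>N\<close> the eigenvalues are \<open>exp (h \<mu>)\<close> with \<open>\<mu>\<close> a left eigenvalue of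
  \<open>A\<close> on \<open>N\<close>; a left eigenvector lies in \<open>N\<close> iff its eigenvalue is not among the first \<open>r\<close>, since
  it annihilates the generalized eigenspaces of all other eigenvalues but never that of its own. So
  stability is decided by the sign of the real part of the eigenvalue number \<open>r + 1\<close>.
\<close>

section \<open>Complexification\<close>

lemma mat_vector_mult: "mat z *v x = z *s (x :: 'a::semiring_1^'n)"
  by (simp add: vec_eq_iff matrix_vector_mult_def mat_def if_distrib[of "\<lambda>a. a * _"] cong: if_cong)

lemma matrix_diff_ldistrib: "(A :: 'a::comm_ring_1^'n^'m) ** (B - D) = A ** B - A ** D"
  by (simp add: vec_eq_iff matrix_matrix_mult_def algebra_simps sum_subtractf)

lemma matrix_diff_rdistrib: "(B - D) ** (A :: 'a::comm_ring_1^'n^'m) = B ** A - D ** A"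
  by (simp add: vec_eq_iff matrix_matrix_mult_def algebra_simps sum_subtractf)

lemma transpose_diff: "transpose (A - B) = transpose A - transpose B"
  by (simp add: vec_eq_iff transpose_def)

lemma cmat_mult: "cmat (A ** B) = cmat A ** cmat B"
  by (simp add: vec_eq_iff matrix_matrix_mult_def cmat_def)

lemma cmat_add: "cmat (A + B) = cmat A + cmat B"
  by (simp add: vec_eq_iff cmat_def)

lemma cmat_diff: "cmat (A - B) = cmat A - cmat B"
  by (simp add: vec_eq_iff cmat_def)

lemma cmat_scaleR: "cmat (c *\<^sub>R A) = c *\<^sub>R cmat A"
  by (simp add: vec_eq_iff cmat_def complex_eq_iff)

lemma cmat_mat_1: "cmat (mat 1) = mat 1"
  by (simp add: vec_eq_iff cmat_def mat_def)

lemma cmat_transpose: "cmat (transpose A) = transpose (cmat A)"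
  by (simp add: vec_eq_iff transpose_def cmat_def)

text \<open>A real matrix acts on real and imaginary parts separately, so hypotheses about real
  vectors (\<open>pd\<close>, \<open>observable\<close>) transfer to complex eigenvectors.\<close>

definition revec :: "complex^'n \<Rightarrow> real^'n" where "revec x = (\<chi> i. Re (x $ i))"
definition imvec :: "complex^'n \<Rightarrow> real^'n" where "imvec x = (\<chi> i. Im (x $ i))"

lemma revec_cmat_mult: "revec (cmat A *v x) = A *v revec x"
  by (simp add: vec_eq_iff revec_def cmat_def matrix_vector_mult_def Re_sum)

lemma imvec_cmat_mult: "imvec (cmat A *v x) = A *v imvec x"
  by (simp add: vec_eq_iff imvec_def cmat_def matrix_vector_mult_def Im_sum)

lemma complex_vec_eq_0_iff: "x = 0 \<longleftrightarrow> revec x = 0 \<and> imvec x = 0"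
  by (auto simp: vec_eq_iff revec_def imvec_def complex_eq_iff)

text \<open>The inner product on \<open>complex^'n\<close> is real-valued, the real part of the
  Hermitian form; with respect to it the adjoint of a real matrix is its transpose.\<close>

lemma inner_revec_imvec: "x \<bullet> y = revec x \<bullet> revec y + imvec x \<bullet> imvec y"
  by (simp add: inner_vec_def revec_def imvec_def inner_complex_def sum.distrib)

lemma inner_cmat_adjoint: "x \<bullet> (cmat A *v y) = (cmat (transpose A) *v x) \<bullet> y"
  unfolding inner_revec_imvec revec_cmat_mult imvec_cmat_mult
  by (simp add: transpose_matrix_vector dot_lmul_matrix)

lemma inner_vector_scalar_mult:
  fixes x y :: "complex^'n"
  shows "(z *s x) \<bullet> (z *s y) = (cmod z)\<^sup>2 * (x \<bullet> y)"
proof -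
  have "(z * a) \<bullet> (z * b) = (cmod z)\<^sup>2 * (a \<bullet> b)" for a b
    unfolding cmod_power2 inner_complex_def by (simp add: algebra_simps power2_eq_square)
  then show ?thesis
    by (simp add: inner_vec_def sum_distrib_left)
qed

lemma pd_imp_inner_cmat_pos:
  assumes "pd P" "x \<noteq> 0"
  shows "0 < x \<bullet> (cmat P *v x)"
proof -
  have *: "0 \<le> a \<bullet> (P *v a)" "a \<noteq> 0 \<Longrightarrow> 0 < a \<bullet> (P *v a)" for a
    using assms(1) unfolding pd_def by (cases "a = 0"; force)+
  show ?thesis
    using assms(2) unfolding inner_revec_imvec revec_cmat_mult imvec_cmat_mult complex_vec_eq_0_iff[of x]
    by (metis *(1,2) add_pos_nonneg add_nonneg_pos)
qed

section \<open>Eigenvectors\<close>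

lemma mpow_0 [simp]: "mpow M 0 = mat 1"
  by (simp add: mpow_def)

lemma mpow_Suc: "mpow M (Suc k) = M ** mpow M k"
  by (simp add: mpow_def)

lemma mpow_add: "mpow M (j + k) = mpow M j ** mpow M k"
  by (induction j) (simp_all add: mpow_Suc matrix_mul_assoc)

lemma mpow_Suc2: "mpow M (Suc k) = mpow M k ** M"
  using mpow_add[of M k 1] by (simp add: mpow_Suc)

lemma mpow_transpose: "mpow (transpose M) k = transpose (mpow M k)"
proof (induction k)
  case (Suc k)
  have "mpow (transpose M) (Suc k) = transpose M ** transpose (mpow M k)"
    by (simp add: mpow_Suc Suc)
  also have "\<dots> = transpose (mpow M (Suc k))"
    by (simp add: mpow_Suc2 matrix_transpose_mul)
  finally show ?case .
qed simp

text \<open>\<open>U\<close> may be rectangular, so \<open>B\<close> can be the action of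
  \<open>M\<close> on an invariant subspace; the choice \<open>B = M\<close> covers powers of
  commuting matrices.\<close>

lemma mpow_intertwine:
  assumes "M ** U = U ** B"
  shows "mpow M k ** U = U ** mpow B k"
proof (induction k)
  case (Suc k)
  have "mpow M (Suc k) ** U = M ** (mpow M k ** U)"
    by (simp add: mpow_Suc matrix_mul_assoc)
  also have "\<dots> = M ** U ** mpow B k"
    by (simp add: Suc matrix_mul_assoc)
  also have "\<dots> = U ** mpow B (Suc k)"
    by (simp add: assms mpow_Suc matrix_mul_assoc)
  finally show ?case .
qed simp

lemma mpow_cmat: "mpow (cmat M) k = cmat (mpow M k)"
  by (induction k) (simp_all add: mpow_Suc cmat_mult cmat_mat_1)

lemma mpow_eigenvector:
  fixes M :: "'a::field^'n^'n"
  assumes "M *v x = z *s x"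
  shows "mpow M k *v x = z ^ k *s x"
  by (induction k)
    (simp_all add: mpow_Suc assms matrix_vector_mul_assoc[symmetric] vector_scalar_commute mult.commute)

section \<open>Eigenvalues through left eigenvectors\<close>

lemma charpoly_at_eq_0_iff:
  "charpoly_at M z = 0 \<longleftrightarrow> (\<exists>x. x \<noteq> 0 \<and> cmat M *v x = z *s x)"
proof -
  let ?D = "mat z - cmat M"
  have "charpoly_at M z = det ?D"
    by (simp add: charpoly_at_def mat_def)
  moreover have "det ?D = 0 \<longleftrightarrow> \<not> (\<forall>x. ?D *v x = 0 \<longrightarrow> x = 0)"
    by (simp add: matrix_left_invertible_ker[symmetric] invertible_left_inverse[symmetric] invertible_det_nz)
  moreover have "?D *v x = z *s x - cmat M *v x" for x
    by (simp add: matrix_vector_mult_diff_rdistrib mat_vector_mult)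
  ultimately show ?thesis
    by auto
qed

lemma charpoly_at_transpose: "charpoly_at (transpose M) z = charpoly_at M z"
proof -
  have "mat z - cmat (transpose M) = transpose (mat z - cmat M)"
    by (simp add: cmat_transpose transpose_diff)
  then show ?thesis
    unfolding charpoly_at_def by (metis det_transpose mat_def)
qed

text \<open>A matrix and its transpose share their characteristic polynomial. Left eigenvectors suit
  the argument because the annihilator of an invariant subspace is invariant under the
  transpose.\<close>

lemma schur_stable_iff_left_eigenvectors:
  "schur_stable M \<longleftrightarrow> (\<forall>z x. x \<noteq> 0 \<and> cmat (transpose M) *v x = z *s x \<longrightarrow> cmod z < 1)"
  unfolding schur_stable_def charpoly_at_transpose[of M, symmetric] charpoly_at_eq_0_iff by blast

section \<open>Krylov sequences and polynomials in a matrix\<close>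

lemma linear_dependence_of_Suc_card:
  fixes f :: "nat \<Rightarrow> 'a::field^'n"
  obtains c where "\<exists>i\<le>CARD('n). c i \<noteq> 0" "(\<Sum>i\<le>CARD('n). c i *s f i) = 0"
proof (cases "inj_on f {..CARD('n)}")
  case True
  have "vec.dependent (f ` {..CARD('n)})"
  proof (rule ccontr)
    assume "\<not> vec.dependent (f ` {..CARD('n)})"
    then have "card (f ` {..CARD('n)}) \<le> vec.dim (UNIV :: ('a^'n) set)"
      by (intro vec.independent_card_le_dim) auto
    then show False
      by (simp add: card_image[OF True] vec_dim_card del: vec.dim_UNIV)
  qed
  then obtain u where u: "\<exists>v\<in>f ` {..CARD('n)}. u v \<noteq> 0" "(\<Sum>v\<in>f ` {..CARD('n)}. u v *s v) = 0"
    by (auto simp: vec.dependent_finite)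
  show ?thesis
  proof (rule that[of "u \<circ> f"])
    show "\<exists>i\<le>CARD('n). (u \<circ> f) i \<noteq> 0" using u(1) by auto
    show "(\<Sum>i\<le>CARD('n). (u \<circ> f) i *s f i) = 0"
      using u(2) by (simp add: sum.reindex[OF True])
  qed
next
  \<comment> \<open>\<open>vec.dependent\<close> concerns sets, so a repeated vector is treated
    apart: its two occurrences cancel.\<close>
  case False
  then obtain i j where ij: "i \<le> CARD('n)" "j \<le> CARD('n)" "i \<noteq> j" "f i = f j"
    by (auto simp: inj_on_def)
  let ?c = "\<lambda>k. if k = i then 1 else if k = j then - 1 else (0::'a)"
  have "(\<Sum>k\<le>CARD('n). ?c k *s f k) = (\<Sum>k\<in>{i, j}. ?c k *s f k)"
    using ij by (intro sum.mono_neutral_right) auto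
  also have "\<dots> = 0"
    using ij by (simp add: vector_sneg_minus1[symmetric])
  finally show ?thesis
    using that[of ?c] ij(1) by (metis zero_neq_one)
qed

text \<open>All powers of \<open>T\<close> above \<open>n\<close> annihilate \<open>u\<close>. In a
  linear relation among \<open>u\<close>, ..., \<open>T^n u\<close> whose lowest nonzero coefficient
  has index \<open>j\<close>, applying \<open>T^(n-j)\<close> therefore kills every term except the
  one with \<open>T^n u\<close>.\<close>

lemma mpow_kernel_stable:
  fixes T :: "'a::field^'n^'n"
  assumes "mpow T (Suc CARD('n)) *v u = 0"
  shows "mpow T CARD('n) *v u = 0"
proof -
  let ?n = "CARD('n)"
  have zero: "mpow T k *v u = 0" if "k > ?n" for k
  proof -
    have "k = (k - Suc ?n) + Suc ?n" using that by simp
    then have "mpow T k = mpow T (k - Suc ?n) ** mpow T (Suc ?n)"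
      by (metis mpow_add)
    then show ?thesis
      by (simp add: matrix_vector_mul_assoc[symmetric] assms)
  qed
  obtain c where c: "\<exists>i\<le>?n. c i \<noteq> 0" "(\<Sum>i\<le>?n. c i *s (mpow T i *v u)) = 0"
    using linear_dependence_of_Suc_card[of "\<lambda>i. mpow T i *v u"] by metis
  define j where "j = (LEAST i. i \<le> ?n \<and> c i \<noteq> 0)"
  have j: "j \<le> ?n" "c j \<noteq> 0"
    using LeastI_ex[of "\<lambda>i. i \<le> ?n \<and> c i \<noteq> 0"] c(1) unfolding j_def by auto
  have least: "c i = 0" if "i < j" for i
    using not_less_Least[of i "\<lambda>i. i \<le> ?n \<and> c i \<noteq> 0"] that j unfolding j_def by auto
  have "0 = mpow T (?n - j) *v (\<Sum>i\<le>?n. c i *s (mpow T i *v u))"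
    by (simp add: c(2))
  also have "\<dots> = (\<Sum>i\<le>?n. c i *s (mpow T (?n - j + i) *v u))"
    by (simp add: vec.linear_sum[OF matrix_vector_mul_linear_gen] vector_scalar_commute
        matrix_vector_mul_assoc mpow_add)
  also have "\<dots> = (\<Sum>i\<in>{j}. c i *s (mpow T (?n - j + i) *v u))"
  proof (rule sum.mono_neutral_right)
    show "\<forall>i\<in>{..?n} - {j}. c i *s (mpow T (?n - j + i) *v u) = 0"
    proof
      fix i assume "i \<in> {..?n} - {j}"
      then have "i < j \<or> ?n - j + i > ?n" using j by auto
      then show "c i *s (mpow T (?n - j + i) *v u) = 0"
        using least zero by auto
    qed
  qed (use j in auto)
  finally show ?thesis
    using j by simp
qed

text \<open>This is \<open>p(L) w\<close>, the polynomial \<open>p\<close> in the matrix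
  \<open>L\<close> applied to \<open>w\<close>.\<close>

definition poly_act :: "'a::field^'n^'n \<Rightarrow> 'a^'n \<Rightarrow> 'a poly \<Rightarrow> 'a^'n" where
  "poly_act L w p = (\<Sum>i\<le>degree p. coeff p i *s (mpow L i *v w))"

lemma poly_act_altdef:
  assumes "degree p \<le> m"
  shows "poly_act L w p = (\<Sum>i\<le>m. coeff p i *s (mpow L i *v w))"
  unfolding poly_act_def using assms
  by (intro sum.mono_neutral_left) (auto simp: coeff_eq_0)

lemma poly_act_linear_factor:
  "poly_act L w ([:- \<mu>, 1:] * q) = L *v poly_act L w q - \<mu> *s poly_act L w q"
proof -
  let ?m = "Suc (degree q)"
  have "degree ([:- \<mu>, 1:] * q) \<le> ?m"
    using degree_mult_le[of "[:- \<mu>, 1:]" q] by simp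
  then have "poly_act L w ([:- \<mu>, 1:] * q)
      = (\<Sum>i\<le>?m. coeff ([:- \<mu>, 1:] * q) i *s (mpow L i *v w))"
    by (rule poly_act_altdef)
  also have "\<dots> = (\<Sum>i\<le>?m. coeff (pCons 0 q) i *s (mpow L i *v w))
      - (\<Sum>i\<le>?m. \<mu> *s (coeff q i *s (mpow L i *v w)))"
    unfolding sum_subtractf[symmetric]
    by (intro sum.cong) (simp_all add: vector_sub_rdistrib)
  also have "(\<Sum>i\<le>?m. coeff (pCons 0 q) i *s (mpow L i *v w)) = L *v poly_act L w q"
    unfolding sum.atMost_Suc_shift poly_act_def
    by (simp add: vec.linear_sum[OF matrix_vector_mul_linear_gen] vector_scalar_commute
        mpow_Suc matrix_vector_mul_assoc)
  also have "(\<Sum>i\<le>?m. \<mu> *s (coeff q i *s (mpow L i *v w))) = \<mu> *s poly_act L w q"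
    by (subst poly_act_altdef[of q ?m]) (simp, simp only: vec.scale_sum_right)
  finally show ?thesis .
qed

text \<open>A nonzero polynomial \<open>p\<close> of least degree with \<open>p(L) w = 0\<close> has
  a complex root \<open>\<mu>\<close>. With \<open>p = (X - \<mu>) q\<close>, the vector
  \<open>q(L) w\<close> is nonzero by minimality and is the required eigenvector.\<close>

lemma eigenvector_in_invariant_subspace:
  fixes L :: "complex^'n^'n"
  assumes S: "vec.subspace S" and inv: "\<And>x. x \<in> S \<Longrightarrow> L *v x \<in> S"
    and w: "w \<in> S" "w \<noteq> 0"
  obtains x \<mu> where "x \<in> S" "x \<noteq> 0" "L *v x = \<mu> *s x"
proof -
  let ?n = "CARD('n)"
  obtain c where c: "\<exists>i\<le>?n. c i \<noteq> 0" "(\<Sum>i\<le>?n. c i *s (mpow L i *v w)) = 0"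
    using linear_dependence_of_Suc_card[of "\<lambda>i. mpow L i *v w"] by metis
  define p0 where "p0 = (\<Sum>i\<le>?n. monom (c i) i)"
  have coeff_p0: "coeff p0 i = (if i \<le> ?n then c i else 0)" for i
    by (simp add: p0_def coeff_sum)
  have "degree p0 \<le> ?n"
    by (rule degree_le) (simp add: coeff_p0)
  then have "poly_act L w p0 = 0"
    using c(2) by (simp add: poly_act_altdef coeff_p0)
  moreover have "p0 \<noteq> 0"
    using c(1) coeff_p0 by (metis coeff_0)
  ultimately have "\<exists>p. p \<noteq> 0 \<and> poly_act L w p = 0" by blast
  then obtain p where p: "p \<noteq> 0" "poly_act L w p = 0"
    and least: "\<And>q. q \<noteq> 0 \<Longrightarrow> poly_act L w q = 0 \<Longrightarrow> degree p \<le> degree q"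
    using ex_has_least_nat[of "\<lambda>p. p \<noteq> 0 \<and> poly_act L w p = 0" _ degree] by blast
  have "degree p \<noteq> 0"
  proof
    assume deg: "degree p = 0"
    then have "coeff p 0 *s w = 0" using p(2) by (simp add: poly_act_def)
    then show False using w(2) p(1) deg by (metis vector_mul_eq_0 leading_coeff_0_iff)
  qed
  then obtain \<mu> where "poly p \<mu> = 0"
    using fundamental_theorem_of_algebra[of p] by (auto simp: constant_degree)
  then obtain q where q: "p = [:- \<mu>, 1:] * q"
    using poly_eq_0_iff_dvd by (metis dvdE)
  have "q \<noteq> 0" using p(1) q by auto
  then have "degree p = Suc (degree q)"
    unfolding q by (subst degree_mult_eq) auto
  then have "poly_act L w q \<noteq> 0" using least[of q] \<open>q \<noteq> 0\<close> by auto
  moreover have "mpow L i *v w \<in> S" for i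
    by (induction i) (use w inv in \<open>simp_all add: mpow_Suc matrix_vector_mul_assoc[symmetric]\<close>)
  then have "poly_act L w q \<in> S"
    unfolding poly_act_def by (intro vec.subspace_sum[OF S] vec.subspace_scale[OF S])
  moreover have "L *v poly_act L w q = \<mu> *s poly_act L w q"
    using p(2) unfolding q poly_act_linear_factor by simp
  ultimately show ?thesis using that by blast
qed


section \<open>Generalized eigenspaces and left eigenvectors\<close>

lemma scalar_product_matrix:
  fixes P :: "'a::comm_ring_1^'n^'m"
  shows "scalar_product (P *v x) u = scalar_product x (transpose P *v u)"
  unfolding scalar_product_def matrix_vector_mult_def transpose_def
  by (simp add: sum_distrib_left sum_distrib_right mult_ac) (rule sum.swap)

lemma scalar_product_sum_left:
  "scalar_product (\<Sum>i\<in>I. f i) w = (\<Sum>i\<in>I. scalar_product (f i) (w :: 'a::comm_ring_1^'n))"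
  unfolding scalar_product_def by (simp add: sum_distrib_right) (rule sum.swap)

lemma scalar_product_scale_right:
  "scalar_product x (c *s w) = c * scalar_product x (w :: 'a::comm_ring_1^'n)"
  by (simp add: scalar_product_def sum_distrib_left mult_ac)

lemma scalar_product_zero [simp]:
  "scalar_product x 0 = 0" "scalar_product 0 x = 0"
  by (simp_all add: scalar_product_def)

lemma scalar_product_axis: "scalar_product (axis i 1) (w :: 'a::comm_ring_1^'n) = w $ i"
  by (simp add: scalar_product_def axis_def if_distrib[of "\<lambda>a. a * _"] cong: if_cong)

text \<open>\<open>scalar_product\<close> is bilinear, without conjugation; conjugating one argument
  recovers the Hermitian form behind the inner product.\<close>

definition cnjvec :: "complex^'n \<Rightarrow> complex^'n" where "cnjvec x = (\<chi> i. cnj (x $ i))"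

lemma inner_eq_Re_scalar_product: "x \<bullet> y = Re (scalar_product (cnjvec x) y)"
  by (simp add: inner_vec_def inner_complex_def scalar_product_def cnjvec_def Re_sum)

lemma scalar_product_comm: "scalar_product x y = scalar_product y (x :: 'a::comm_ring_1^'n)"
  by (simp add: scalar_product_def mult.commute)

text \<open>Finite-dimensional duality: the component of \<open>w\<close> orthogonal to the range of
  the transpose, once conjugated, lies in the kernel of \<open>P\<close>, and the hypothesis then
  makes it vanish.\<close>

lemma annihilator_of_kernel:
  fixes P :: "complex^'n^'m"
  assumes "\<And>x. P *v x = 0 \<Longrightarrow> scalar_product x w = 0"
  obtains u where "w = transpose P *v u"
proof -
  let ?S = "range (\<lambda>u. transpose P *v u)"
  have lin: "linear (\<lambda>u. transpose P *v u)" by simp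
  then have span: "span ?S = ?S"
    using linear_subspace_image[OF lin subspace_UNIV] by (simp only: span_eq_iff)
  obtain y z where yz: "y \<in> ?S" "\<And>v. v \<in> ?S \<Longrightarrow> orthogonal z v" "w = y + z"
    using orthogonal_subspace_decomp_exists[of ?S w] unfolding span by metis
  let ?x = "cnjvec z"
  have orth: "Re (scalar_product (P *v ?x) u) = 0" for u
    using yz(2)[of "transpose P *v u"]
    by (simp add: orthogonal_def inner_eq_Re_scalar_product scalar_product_matrix)
  \<comment> \<open>Taking \<open>u\<close> in \<open>orth\<close> as the conjugate of
    \<open>P *v ?x\<close> gives the squared norm.\<close>
  have "(P *v ?x) \<bullet> (P *v ?x) = 0"
    unfolding inner_eq_Re_scalar_product using orth by (metis scalar_product_comm)
  then have "scalar_product ?x w = 0"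
    using assms by simp
  then have "z \<bullet> w = 0"
    by (simp add: inner_eq_Re_scalar_product)
  moreover have "z \<bullet> y = 0"
    using yz(1,2) by (simp add: orthogonal_def)
  ultimately have "z = 0"
    using yz(3) by (simp add: inner_add_right)
  then show ?thesis
    using yz that by auto
qed

section \<open>Generalized eigenspaces\<close>

lemma gen_eigenspace_iff:
  fixes M :: "real^'n^'n"
  shows "v \<in> gen_eigenspace M \<mu> \<longleftrightarrow> mpow (cmat M - mat \<mu>) CARD('n) *v v = 0"
  by (simp add: gen_eigenspace_def mat_def)

lemma mat_commute: "mat c ** B = B ** mat (c :: 'a::comm_ring_1)"
  by (simp add: vec_eq_iff matrix_matrix_mult_def mat_def mult.commute
      if_distrib[of "\<lambda>a. a * _"] if_distrib[of "\<lambda>a. _ * a"] cong: if_cong)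

lemma gen_eigenspace_invariant:
  assumes "v \<in> gen_eigenspace M \<mu>"
  shows "cmat M *v v \<in> gen_eigenspace M \<mu>"
proof -
  have "(cmat M - mat \<mu>) ** cmat M = cmat M ** (cmat M - mat \<mu>)"
    by (simp add: matrix_diff_ldistrib matrix_diff_rdistrib mat_commute)
  then show ?thesis
    using assms unfolding gen_eigenspace_iff
    by (metis matrix_vector_mul_assoc matrix_vector_mult_0_right mpow_intertwine)
qed

lemma transpose_shift_eigenvector:
  assumes "cmat (transpose M) *v w = \<mu> *s w"
  shows "transpose (cmat M - mat \<nu>) *v w = (\<mu> - \<nu>) *s w"
  using assms
  by (simp add: transpose_diff cmat_transpose matrix_vector_mult_diff_rdistrib mat_vector_mult
      vector_sub_rdistrib)

text \<open>Moving the \<open>n\<close>-th power of \<open>M - \<nu>\<close> across the pairing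
  turns it into multiplication of \<open>w\<close> by the nonzero scalar
  \<open>(\<mu> - \<nu>) ^ n\<close>.\<close>

lemma left_eigenvector_annihilates_gen_eigenspace:
  assumes "cmat (transpose M) *v w = \<mu> *s w" "x \<in> gen_eigenspace M \<nu>" "\<nu> \<noteq> \<mu>"
  shows "scalar_product x w = 0"
proof -
  let ?T = "cmat M - mat \<nu>" and ?n = "CARD('a)"
  have "0 = scalar_product (mpow ?T ?n *v x) w"
    using assms(2) by (simp add: gen_eigenspace_iff)
  also have "\<dots> = scalar_product x ((\<mu> - \<nu>) ^ ?n *s w)"
    unfolding scalar_product_matrix mpow_transpose[symmetric]
    by (simp only: mpow_eigenvector[OF transpose_shift_eigenvector[OF assms(1)]])
  finally show ?thesis
    using assms(3) by (simp add: scalar_product_scale_right)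
qed

text \<open>A functional vanishing on the kernel of \<open>T\<^sup>n\<close> lies in the range of the transpose of \<open>T\<^sup>n\<close>,
  where the transpose of \<open>T\<close> is injective.\<close>

lemma left_eigenvector_nonzero_on_gen_eigenspace:
  fixes M :: "real^'n^'n"
  assumes "cmat (transpose M) *v w = \<mu> *s w"
    and "\<And>x. x \<in> gen_eigenspace M \<mu> \<Longrightarrow> scalar_product x w = 0"
  shows "w = 0"
proof -
  let ?T = "cmat M - mat \<mu>" and ?n = "CARD('n)"
  obtain u where u: "w = mpow (transpose ?T) ?n *v u"
    using annihilator_of_kernel[of "mpow ?T ?n" w] assms(2)
    by (auto simp: gen_eigenspace_iff mpow_transpose)
  have "transpose ?T *v w = 0"
    using transpose_shift_eigenvector[OF assms(1), of \<mu>] by simp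
  then have "mpow (transpose ?T) (Suc ?n) *v u = 0"
    by (simp add: u mpow_Suc matrix_vector_mul_assoc)
  then show ?thesis
    unfolding u by (rule mpow_kernel_stable)
qed

lemma gen_eigenspace_subset_top_invariant_subspace:
  assumes "\<mu> \<in> set (take r ls)"
  shows "gen_eigenspace M \<mu> \<subseteq> top_invariant_subspace M ls r"
proof
  fix v assume v: "v \<in> gen_eigenspace M \<mu>"
  let ?f = "\<lambda>\<nu>. if \<nu> = \<mu> then v else 0"
  have "\<forall>\<nu>\<in>set (take r ls). ?f \<nu> \<in> gen_eigenspace M \<nu>"
    using v by (auto simp: gen_eigenspace_iff)
  moreover have "v = (\<Sum>\<nu>\<in>set (take r ls). ?f \<nu>)"
    using assms by (simp add: sum.delta)
  ultimately show "v \<in> top_invariant_subspace M ls r"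
    unfolding top_invariant_subspace_def by (intro CollectI exI[of _ ?f] conjI)
qed

lemma top_invariant_subspace_invariant:
  assumes "x \<in> top_invariant_subspace M ls r"
  shows "cmat M *v x \<in> top_invariant_subspace M ls r"
proof -
  obtain f where f: "\<forall>\<mu>\<in>set (take r ls). f \<mu> \<in> gen_eigenspace M \<mu>"
    "x = (\<Sum>\<mu>\<in>set (take r ls). f \<mu>)"
    using assms unfolding top_invariant_subspace_def by blast
  have "cmat M *v x = (\<Sum>\<mu>\<in>set (take r ls). cmat M *v f \<mu>)"
    by (simp add: f(2) vec.linear_sum[OF matrix_vector_mul_linear_gen])
  then show ?thesis
    unfolding top_invariant_subspace_def using f(1) gen_eigenspace_invariant
    by (intro CollectI exI[of _ "\<lambda>\<mu>. cmat M *v f \<mu>"]) auto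
qed

section \<open>The matrix exponential\<close>

text \<open>The norm is the Euclidean one on the entries; boundedness of bilinear maps in finite
  dimension gives some constant, which suffices for convergence.\<close>

lemma norm_matrix_mult_le:
  obtains c where "c \<ge> 0"
    "\<And>A B. norm ((A :: real^'n^'n) ** (B :: real^'n^'n)) \<le> norm A * norm B * c"
proof -
  have "bilinear (\<lambda>(A :: real^'n^'n) (B :: real^'n^'n). A ** B)"
    unfolding bilinear_def
    by (auto intro!: linearI simp: vec_eq_iff matrix_matrix_mult_def algebra_simps sum.distrib
        sum_distrib_left)
  then have "bounded_bilinear (\<lambda>(A :: real^'n^'n) (B :: real^'n^'n). A ** B)"
    by (simp add: bilinear_conv_bounded_bilinear)
  from bounded_bilinear.nonneg_bounded[OF this] show ?thesis
    using that by blast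
qed

text \<open>Comparison with the scalar exponential series of \<open>norm M * c\<close>.\<close>

lemma mexp_sums:
  fixes M :: "real^'n^'n"
  shows "(\<lambda>k. (1 / fact k) *\<^sub>R mpow M k) sums mexp M"
proof -
  obtain c where c: "c \<ge> 0" "\<And>A B. norm ((A :: real^'n^'n) ** (B :: real^'n^'n)) \<le> norm A * norm B * c"
    using norm_matrix_mult_le by blast
  let ?b = "norm M * c" and ?e = "norm (mat 1 :: real^'n^'n)"
  have bound: "norm (mpow M k) \<le> ?b ^ k * ?e" for k
  proof (induction k)
    case (Suc k)
    have "norm (mpow M (Suc k)) \<le> norm M * norm (mpow M k) * c"
      unfolding mpow_Suc by (rule c(2))
    also have "\<dots> = ?b * norm (mpow M k)" by simp
    also have "\<dots> \<le> ?b * (?b ^ k * ?e)"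
      using Suc c(1) by (intro mult_left_mono) auto
    finally show ?case by simp
  qed simp
  have "summable (\<lambda>k. inverse (fact k) * ?b ^ k * ?e)"
    by (intro summable_mult2 summable_exp)
  then have "summable (\<lambda>k. (1 / fact k) *\<^sub>R mpow M k)"
    by (rule summable_comparison_test') (use bound in \<open>simp add: field_simps divide_right_mono\<close>)
  then show ?thesis
    unfolding mexp_def by (rule summable_sums)
qed

text \<open>A linear map on matrices is continuous and passes through the series; the rules for
  intertwining, transposition and eigenvectors all follow from this.\<close>

lemma sums_linear_mexp:
  fixes f :: "real^'n^'n \<Rightarrow> 'a::real_normed_vector"
  assumes "linear f"
  shows "(\<lambda>k. (1 / fact k) *\<^sub>R f (mpow M k)) sums f (mexp M)"
  using bounded_linear.sums[OF _ mexp_sums, of f M] assms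
  by (simp add: linear_conv_bounded_linear linear_cmul)

lemma mexp_intertwine:
  fixes U :: "real^'r^'n"
  assumes "M ** U = U ** B"
  shows "mexp M ** U = U ** mexp B"
proof -
  have "linear (\<lambda>X. X ** U)" "linear (\<lambda>X. U ** X)"
    by (auto intro!: linearI simp: vec_eq_iff matrix_matrix_mult_def algebra_simps sum.distrib
        sum_distrib_left)
  from sums_linear_mexp[OF this(1), of M] sums_linear_mexp[OF this(2), of B]
  show ?thesis
    unfolding mpow_intertwine[OF assms] by (rule sums_unique2)
qed

lemma mexp_transpose: "mexp (transpose M) = transpose (mexp M)"
proof -
  have "linear (transpose :: real^'n^'n \<Rightarrow> real^'n^'n)"
    by (auto intro!: linearI simp: vec_eq_iff transpose_def)
  from sums_linear_mexp[OF this, of M] mexp_sums[of "transpose M"]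
  show ?thesis
    unfolding mpow_transpose by (rule sums_unique2[symmetric])
qed

lemma mexp_eigenvector:
  assumes "cmat M *v x = z *s x"
  shows "cmat (mexp M) *v x = exp z *s x"
proof -
  have "linear (\<lambda>X. cmat X *v x)"
    by (auto intro!: linearI simp: cmat_add cmat_scaleR matrix_vector_mult_add_rdistrib)
      (simp add: vec_eq_iff matrix_vector_mult_def scaleR_sum_right)
  from sums_linear_mexp[OF this, of M]
  have "(\<lambda>k. (z ^ k /\<^sub>R fact k) *s x) sums (cmat (mexp M) *v x)"
    unfolding mpow_cmat[symmetric] mpow_eigenvector[OF assms]
    by (simp add: vec_eq_iff inverse_eq_divide scaleR_conv_of_real vector_scalar_mult_def scaleR_vec_def)
  moreover have "bounded_linear (\<lambda>a. a *s x)"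
    unfolding linear_conv_bounded_linear[symmetric]
    by (auto intro!: linearI simp: vec_eq_iff algebra_simps)
  from bounded_linear.sums[OF this exp_converges[of z]]
  have "(\<lambda>k. (z ^ k /\<^sub>R fact k) *s x) sums (exp z *s x)" .
  ultimately show ?thesis
    by (rule sums_unique2)
qed


section \<open>The Riccati equation\<close>

lemma pd_gram_invertible:
  fixes H :: "real^'n^'n"
  assumes "det H \<noteq> 0"
  shows "pd (H ** transpose H)"
  unfolding pd_def
proof (intro conjI allI impI)
  show "transpose (H ** transpose H) = H ** transpose H"
    by (simp add: matrix_transpose_mul)
  fix x :: "real^'n" assume "x \<noteq> 0"
  have "inj ((*v) (transpose H))"
    using assms by (intro inj_matrix_vector_mult) (simp add: invertible_det_nz)
  then have "transpose H *v x \<noteq> 0"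
    using \<open>x \<noteq> 0\<close> by (metis injD matrix_vector_mult_0_right)
  moreover have "x \<bullet> ((H ** transpose H) *v x) = (transpose H *v x) \<bullet> (transpose H *v x)"
    by (simp add: matrix_vector_mul_assoc[symmetric] transpose_matrix_vector dot_lmul_matrix)
  ultimately show "0 < x \<bullet> ((H ** transpose H) *v x)"
    by simp
qed

lemma pd_imp_invertible:
  assumes "pd S"
  shows "invertible S"
  unfolding invertible_left_inverse matrix_left_invertible_ker
  using assms unfolding pd_def by (metis inner_zero_right less_irrefl)

lemma matrix_inv_left:
  assumes "invertible (S :: real^'n^'n)"
  shows "matrix_inv S ** S = mat 1"
  using someI_ex[OF assms[unfolded invertible_def]] unfolding matrix_inv_def by simp

lemma pd_innovation_covariance:
  fixes C :: "real^'r^'p"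
  assumes "pd R" "pd M"
  shows "pd (C ** R ** transpose C + M)"
  unfolding pd_def
proof (intro conjI allI impI)
  have "transpose (A + B) = transpose A + transpose B" for A B :: "real^'p^'p"
    by (simp add: vec_eq_iff transpose_def)
  then show "transpose (C ** R ** transpose C + M) = C ** R ** transpose C + M"
    using assms by (simp add: matrix_transpose_mul pd_def matrix_mul_assoc)
  fix x :: "real^'p" assume "x \<noteq> 0"
  let ?y = "transpose C *v x"
  have "x \<bullet> ((C ** R ** transpose C) *v x) = ?y \<bullet> (R *v ?y)"
    by (simp add: matrix_vector_mul_assoc[symmetric] transpose_matrix_vector dot_lmul_matrix)
  moreover have "0 \<le> ?y \<bullet> (R *v ?y)"
    using assms(1) by (cases "?y = 0") (auto simp: pd_def less_imp_le)
  ultimately show "0 < x \<bullet> ((C ** R ** transpose C + M) *v x)"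
    using assms(2) \<open>x \<noteq> 0\<close>
    by (simp add: pd_def matrix_vector_mult_add_rdistrib inner_add_right add_nonneg_pos)
qed

text \<open>The innovation covariance is positive definite, hence invertible. Afterwards the gain is
  used only through this equation.\<close>

lemma kalman_gain_mult_innovation_covariance:
  assumes "pd R" "pd M"
  shows "kalman_gain C M R ** (C ** R ** transpose C + M) = R ** transpose C"
proof -
  let ?S = "C ** R ** transpose C + M"
  have "kalman_gain C M R ** ?S = R ** transpose C ** (matrix_inv ?S ** ?S)"
    unfolding kalman_gain_def by (simp add: matrix_mul_assoc)
  then show ?thesis
    by (simp add: matrix_inv_left pd_imp_invertible pd_innovation_covariance assms)
qed

text \<open>Since \<open>F M = (I - F C) R C^T\<close>, the cross terms cancel and
  \<open>(I - F C) R (I - F C)^T + F M F^T = (I - F C) R\<close>. In this form the closed loop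
  \<open>Ac\<close> appears and every summand is positive semidefinite.\<close>

lemma joseph_form:
  fixes A :: "real^'r^'r" and C :: "real^'r^'p" and G :: "real^'m^'r"
  assumes "pd R" "pd M" "dare A G C M R"
  defines "F \<equiv> kalman_gain C M R"
  defines "Ac \<equiv> A ** (mat 1 - F ** C)"
  shows "R = Ac ** R ** transpose Ac + A ** F ** M ** transpose F ** transpose A + G ** transpose G"
proof -
  let ?S = "C ** R ** transpose C + M"
  have "F ** ?S = R ** transpose C"
    unfolding F_def by (rule kalman_gain_mult_innovation_covariance[OF assms(1,2)])
  then have "F ** C ** R ** transpose C + F ** M = R ** transpose C"
    by (simp add: matrix_add_ldistrib matrix_mul_assoc)
  then have FM: "F ** M = R ** transpose C - F ** C ** R ** transpose C"
    by (simp add: algebra_simps)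
  have "Ac ** R ** transpose Ac + A ** (F ** M) ** transpose F ** transpose A
      = A ** (R - F ** C ** R) ** transpose A"
    unfolding Ac_def FM
    by (simp add: matrix_diff_ldistrib matrix_diff_rdistrib matrix_transpose_mul transpose_diff matrix_mul_assoc)
  then show ?thesis
    using assms(3) unfolding dare_def F_def[symmetric] by (simp add: matrix_mul_assoc)
qed

text \<open>By the Joseph form, an eigenvector \<open>x\<close> of the transposed closed loop with eigenvalue on the unit
  circle is not affected by the gain, and then \<open>R x\<close> is an unobservable eigenvector of \<open>A\<close>.\<close>

lemma kalman_closed_loop_schur_stable:
  fixes A :: "real^'r^'r" and C :: "real^'r^'p" and G :: "real^'m^'r"
  assumes "pd R" "pd M" "dare A G C M R"
    and obs: "\<And>z y. cmat A *v y = z *s y \<Longrightarrow> cmat C *v y = 0 \<Longrightarrow> y = 0"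
  shows "schur_stable (A ** (mat 1 - kalman_gain C M R ** C))"
  unfolding schur_stable_iff_left_eigenvectors
proof (intro allI impI, elim conjE)
  let ?F = "kalman_gain C M R"
  let ?Ac = "A ** (mat 1 - ?F ** C)"
  fix z and x :: "complex^'r"
  assume x: "x \<noteq> 0" and ev: "cmat (transpose ?Ac) *v x = z *s x"
  let ?w = "cmat (transpose ?F) *v (cmat (transpose A) *v x)"
  let ?g = "cmat (transpose G) *v x"
  have Rx: "cmat R *v x = z *s (cmat ?Ac *v (cmat R *v x))
      + cmat A *v (cmat ?F *v (cmat M *v ?w)) + cmat G *v ?g" (is "_ = ?rhs")
  proof -
    have "cmat R *v x = cmat (?Ac ** R ** transpose ?Ac + A ** ?F ** M ** transpose ?F ** transpose A
        + G ** transpose G) *v x"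
      using joseph_form[OF assms(1-3)] by simp
    also have "\<dots> = cmat ?Ac *v (cmat R *v (cmat (transpose ?Ac) *v x))
      + cmat A *v (cmat ?F *v (cmat M *v ?w)) + cmat G *v ?g"
      by (simp add: cmat_add cmat_mult matrix_vector_mult_add_rdistrib matrix_vector_mul_assoc matrix_mul_assoc)
    also have "\<dots> = ?rhs"
      unfolding ev by (simp add: vector_scalar_commute)
    finally show ?thesis .
  qed
  let ?q = "x \<bullet> (cmat R *v x)"
  have qpos: "?q > 0"
    by (rule pd_imp_inner_cmat_pos[OF assms(1) x])
  have "x \<bullet> (z *s (cmat ?Ac *v (cmat R *v x))) = (cmod z)\<^sup>2 * ?q"
  proof -
    have "x \<bullet> (z *s (cmat ?Ac *v (cmat R *v x))) = (cmat (transpose ?Ac) *v x) \<bullet> (z *s (cmat R *v x))"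
      by (simp only: vector_scalar_commute[symmetric] inner_cmat_adjoint)
    then show ?thesis
      unfolding ev by (simp add: inner_vector_scalar_mult)
  qed
  moreover have "x \<bullet> (cmat A *v (cmat ?F *v (cmat M *v ?w))) = ?w \<bullet> (cmat M *v ?w)"
    by (simp only: inner_cmat_adjoint[of _ A] inner_cmat_adjoint[of _ ?F])
  moreover have "x \<bullet> (cmat G *v ?g) = ?g \<bullet> ?g"
    by (simp only: inner_cmat_adjoint[of _ G])
  \<comment> \<open>Energy balance: pairing with \<open>x\<close> turns the closed-loop term into
    \<open>(cmod z)^2\<close> times the energy \<open>?q\<close>; the gain and noise terms become
    nonnegative quantities.\<close>
  ultimately have q: "?q = (cmod z)\<^sup>2 * ?q + ?w \<bullet> (cmat M *v ?w) + ?g \<bullet> ?g"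
    using arg_cong[OF Rx, of "\<lambda>v. x \<bullet> v"] by (simp add: inner_add_right)
  have w0: "0 \<le> ?w \<bullet> (cmat M *v ?w)"
    using pd_imp_inner_cmat_pos[OF assms(2), of ?w] by (cases "?w = 0") auto
  have g0: "0 \<le> ?g \<bullet> ?g" by simp
  show "cmod z < 1"
  proof (rule ccontr)
    assume "\<not> cmod z < 1"
    then have "1 \<le> (cmod z)\<^sup>2" by simp
    then have "?q \<le> (cmod z)\<^sup>2 * ?q"
      using qpos by simp
    \<comment> \<open>The balance leaves no room for either nonnegative term once
      \<open>cmod z \<ge> 1\<close>.\<close>
    then have "?w \<bullet> (cmat M *v ?w) = 0" "?g \<bullet> ?g = 0"
      using q w0 g0 by linarith+
    then have w: "?w = 0" and g: "?g = 0"
      using pd_imp_inner_cmat_pos[OF assms(2), of ?w] by (metis less_irrefl, simp)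
    have z: "z \<noteq> 0" using \<open>\<not> cmod z < 1\<close> by auto
    \<comment> \<open>The gain enters the transposed closed loop only through \<open>?w\<close>, so
      \<open>x\<close> is a left eigenvector of \<open>A\<close>; as \<open>z\<close> is nonzero,
      \<open>?w = 0\<close> then becomes \<open>F^T x = 0\<close>.\<close>
    have "cmat (transpose ?Ac) *v x = cmat (transpose A) *v x - cmat (transpose C) *v ?w"
      by (simp add: matrix_transpose_mul transpose_diff matrix_diff_rdistrib cmat_diff cmat_mult
          matrix_vector_mult_diff_rdistrib matrix_vector_mul_assoc matrix_mul_assoc)
    then have "cmat (transpose A) *v x = z *s x"
      using ev by (simp add: w)
    with w have "z *s (cmat (transpose ?F) *v x) = 0"
      by (simp only: vector_scalar_commute)
    with z have Fx: "cmat (transpose ?F) *v x = 0" by simp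
    let ?y = "cmat R *v x" and ?S = "C ** R ** transpose C + M"
    have "transpose ?S = ?S"
      using pd_innovation_covariance[OF assms(1,2), of C] by (simp add: pd_def)
    \<comment> \<open>Transposing \<open>F S = R C^T\<close> gives \<open>S F^T = C R\<close>, so
      the vanishing of \<open>F^T x\<close> means that \<open>C\<close> annihilates
      \<open>R x\<close>.\<close>
    then have "?S ** transpose ?F = transpose (?F ** ?S)"
      by (simp add: matrix_transpose_mul)
    also have "?F ** ?S = R ** transpose C"
      by (rule kalman_gain_mult_innovation_covariance[OF assms(1,2)])
    finally have "?S ** transpose ?F = C ** R"
      using assms(1) by (simp add: matrix_transpose_mul pd_def)
    then have "cmat C *v ?y = cmat ?S *v (cmat (transpose ?F) *v x)"
      by (simp only: matrix_vector_mul_assoc cmat_mult[symmetric])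
    then have Cy: "cmat C *v ?y = 0"
      by (simp add: Fx)
    have "cmat ?Ac *v ?y = cmat A *v ?y - cmat A *v (cmat ?F *v (cmat C *v ?y))"
      by (simp add: matrix_diff_ldistrib matrix_diff_rdistrib cmat_diff cmat_mult
          matrix_vector_mult_diff_rdistrib matrix_vector_mul_assoc matrix_mul_assoc)
    moreover have "?y = z *s (cmat ?Ac *v ?y)"
      using Rx by (simp add: w g)
    \<comment> \<open>What remains of the Joseph form makes \<open>R x\<close> an eigenvector of
      \<open>A\<close> for the eigenvalue \<open>inverse z\<close>.\<close>
    ultimately have "?y = z *s (cmat A *v ?y)"
      by (simp add: Cy)
    then have "inverse z *s ?y = inverse z *s (z *s (cmat A *v ?y))" by simp
    then have "cmat A *v ?y = inverse z *s ?y"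
      using z by (simp add: vector_smult_assoc)
    then have "?y = 0" using obs Cy by blast
    then show False using qpos by simp
  qed
qed

section \<open>The low-rank filter\<close>

text \<open>The easy half of the Hautus test: \<open>C A^k v = z^k C v\<close>. Real and imaginary
  parts reduce it to the real vectors in \<open>observable\<close>.\<close>

lemma observable_no_eigenvector_in_kernel:
  assumes "observable C A" "cmat A *v v = z *s v" "cmat C *v v = 0"
  shows "v = 0"
proof -
  have "cmat (C ** mpow A k) *v v = 0" for k
  proof -
    have "cmat (C ** mpow A k) *v v = cmat C *v (z ^ k *s v)"
      by (simp add: cmat_mult mpow_cmat[symmetric] matrix_vector_mul_assoc[symmetric]
          mpow_eigenvector[OF assms(2)])
    then show ?thesis
      by (simp add: vector_scalar_commute assms(3))
  qed
  then have "(C ** mpow A k) *v revec v = 0" "(C ** mpow A k) *v imvec v = 0" for k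
    unfolding complex_vec_eq_0_iff revec_cmat_mult imvec_cmat_mult by blast+
  then show ?thesis
    using assms(1) unfolding observable_def complex_vec_eq_0_iff[of v] by blast
qed

text \<open>Lists count from zero, so \<open>ls ! r\<close> is the eigenvalue number
  \<open>r + 1\<close>; by the ordering, its sign decides whether all nonnegative real parts occur
  among the first \<open>r\<close> entries.\<close>

lemma sorted_count_nonneg_le_iff:
  assumes "sorted_wrt (\<lambda>a b. Re a \<ge> Re b) ls" "r < length ls"
  shows "length (filter (\<lambda>\<mu>. Re \<mu> \<ge> 0) ls) \<le> r \<longleftrightarrow> Re (ls ! r) < 0"
proof
  assume neg: "Re (ls ! r) < 0"
  have "Re \<mu> < 0" if "\<mu> \<in> set (drop r ls)" for \<mu>
  proof -
    obtain i where "i < length ls - r" "\<mu> = ls ! (r + i)"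
      using \<open>\<mu> \<in> set (drop r ls)\<close> by (auto simp: in_set_conv_nth)
    then have "Re \<mu> \<le> Re (ls ! r)"
      using sorted_wrt_nth_less[OF assms(1), of r "r + i"] assms(2) by (cases "i = 0") auto
    with neg show ?thesis by simp
  qed
  then have "filter (\<lambda>\<mu>. Re \<mu> \<ge> 0) (drop r ls) = []"
    by (auto simp: filter_empty_conv not_le)
  then have "filter (\<lambda>\<mu>. Re \<mu> \<ge> 0) ls = filter (\<lambda>\<mu>. Re \<mu> \<ge> 0) (take r ls)"
    by (metis append_take_drop_id append_Nil2 filter_append)
  then show "length (filter (\<lambda>\<mu>. Re \<mu> \<ge> 0) ls) \<le> r"
    by (metis length_filter_le length_take min.bounded_iff)
next
  assume le: "length (filter (\<lambda>\<mu>. Re \<mu> \<ge> 0) ls) \<le> r"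
  show "Re (ls ! r) < 0"
  proof (rule ccontr)
    assume nonneg: "\<not> Re (ls ! r) < 0"
    have "Re \<mu> \<ge> 0" if "\<mu> \<in> set (take (Suc r) ls)" for \<mu>
    proof -
      obtain i where "i < Suc r" "\<mu> = ls ! i"
        using \<open>\<mu> \<in> set (take (Suc r) ls)\<close> by (auto simp: in_set_conv_nth)
      then have "Re \<mu> \<ge> Re (ls ! r)"
        using sorted_wrt_nth_less[OF assms(1), of i r] assms(2) by (cases "i = r") auto
      with nonneg show ?thesis by simp
    qed
    then have "length (filter (\<lambda>\<mu>. Re \<mu> \<ge> 0) (take (Suc r) ls)) = Suc r"
      using assms(2) by simp
    moreover have "length (filter (\<lambda>\<mu>. Re \<mu> \<ge> 0) ls) \<ge> length (filter (\<lambda>\<mu>. Re \<mu> \<ge> 0) (take (Suc r) ls))"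
      by (metis append_take_drop_id filter_append le_add1 length_append)
    ultimately show False using le by simp
  qed
qed

section \<open>The column space of \<open>U\<close> and its annihilator\<close>

lemma cmat_inject: "cmat A = cmat B \<longleftrightarrow> A = B"
  by (simp add: vec_eq_iff cmat_def)

text \<open>The complex column space of \<open>U\<close> is invariant under \<open>A\<close>, and
  \<open>U U^T\<close> fixes it pointwise because \<open>U^T U = 1\<close>.\<close>

lemma U_set_intertwine:
  fixes U :: "real^'r^'n"
  assumes "U \<in> U_set A ls"
  shows "A ** U = U ** (transpose U ** A ** U)"
proof -
  have UU: "transpose U ** U = mat 1"
    and rng: "range (\<lambda>k. cmat U *v k) = top_invariant_subspace A ls CARD('r)"
    using assms by (auto simp: U_set_def)
  have "cmat (A ** U) *v k = cmat (U ** (transpose U ** A ** U)) *v k" for k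
  proof -
    have "cmat A *v (cmat U *v k) \<in> range (\<lambda>k. cmat U *v k)"
      unfolding rng by (rule top_invariant_subspace_invariant) (simp add: rng[symmetric])
    then obtain l where l: "cmat (A ** U) *v k = cmat U *v l"
      by (auto simp: cmat_mult matrix_vector_mul_assoc)
    have "cmat (transpose U) *v (cmat U *v l) = l"
      by (simp add: matrix_vector_mul_assoc cmat_mult[symmetric] UU cmat_mat_1)
    then have "cmat (transpose U) *v (cmat (A ** U) *v k) = l"
      by (simp only: l)
    then have "cmat U *v (cmat (transpose U) *v (cmat (A ** U) *v k)) = cmat (A ** U) *v k"
      by (simp only: l)
    then show ?thesis
      by (simp add: cmat_mult matrix_vector_mul_assoc matrix_mul_assoc)
  qed
  then show ?thesis
    by (simp add: cmat_inject[symmetric] matrix_eq)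
qed

lemma left_kernel_iff_annihilates_range:
  fixes U :: "real^'r^'n"
  shows "cmat (transpose U) *v w = 0 \<longleftrightarrow> (\<forall>k. scalar_product (cmat U *v k) w = 0)"
proof
  assume "\<forall>k. scalar_product (cmat U *v k) w = 0"
  then show "cmat (transpose U) *v w = 0"
    by (metis (no_types) vec_eq_iff zero_index scalar_product_axis scalar_product_matrix cmat_transpose)
qed (simp add: scalar_product_matrix cmat_transpose)

text \<open>The column space is the sum of the generalized eigenspaces of the first \<open>r\<close>
  eigenvalues. If \<open>\<mu>\<close> is among these, \<open>w\<close> cannot annihilate its own
  generalized eigenspace; otherwise \<open>w\<close> annihilates every summand.\<close>

lemma left_eigenvector_in_left_kernel_iff:
  fixes U :: "real^'r^'n"
  assumes "U \<in> U_set A ls" "cmat (transpose A) *v w = \<mu> *s w" "w \<noteq> 0"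
  shows "cmat (transpose U) *v w = 0 \<longleftrightarrow> \<mu> \<notin> set (take CARD('r) ls)"
proof -
  have rng: "range (\<lambda>k. cmat U *v k) = top_invariant_subspace A ls CARD('r)"
    using assms by (auto simp: U_set_def)
  have "cmat (transpose U) *v w = 0
      \<longleftrightarrow> (\<forall>x\<in>range (\<lambda>k. cmat U *v k). scalar_product x w = 0)"
    unfolding left_kernel_iff_annihilates_range by blast
  also have "\<dots> \<longleftrightarrow> \<mu> \<notin> set (take CARD('r) ls)"
    unfolding rng
  proof
    assume "\<forall>x\<in>top_invariant_subspace A ls CARD('r). scalar_product x w = 0"
    then show "\<mu> \<notin> set (take CARD('r) ls)"
      using gen_eigenspace_subset_top_invariant_subspace[of \<mu> "CARD('r)" ls A]
        left_eigenvector_nonzero_on_gen_eigenspace[OF assms(2)] assms(3) by blast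
  next
    assume \<mu>: "\<mu> \<notin> set (take CARD('r) ls)"
    show "\<forall>x\<in>top_invariant_subspace A ls CARD('r). scalar_product x w = 0"
    proof
      fix x assume "x \<in> top_invariant_subspace A ls CARD('r)"
      then obtain f where f: "\<forall>\<nu>\<in>set (take CARD('r) ls). f \<nu> \<in> gen_eigenspace A \<nu>"
        "x = (\<Sum>\<nu>\<in>set (take CARD('r) ls). f \<nu>)"
        unfolding top_invariant_subspace_def by blast
      show "scalar_product x w = 0"
        unfolding f(2) scalar_product_sum_left
        using f(1) \<mu> left_eigenvector_annihilates_gen_eigenspace[OF assms(2)]
        by (intro sum.neutral) blast
    qed
  qed
  finally show ?thesis .
qed

lemma left_eigenvector_disc_A:
  assumes "cmat (transpose A) *v w = \<mu> *s w"
  shows "cmat (transpose (disc_A h A)) *v w = exp (of_real h * \<mu>) *s w"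
proof -
  have "cmat (transpose (h *\<^sub>R A)) *v w = (of_real h * \<mu>) *s w"
  proof -
    have "cmat (transpose (h *\<^sub>R A)) *v w = h *\<^sub>R (cmat (transpose A) *v w)"
      by (simp add: transpose_scalar cmat_scaleR)
        (simp add: vec_eq_iff matrix_vector_mult_def scaleR_sum_right)
    then show ?thesis
      by (simp add: assms vec_eq_iff scaleR_conv_of_real[where 'a = complex])
  qed
  then show ?thesis
    unfolding disc_A_def mexp_transpose[symmetric] by (rule mexp_eigenvector)
qed

theorem theorem1:
  fixes A :: "real^'n^'n" and G :: "real^'q^'n" and C :: "real^'n^'p"
    and H :: "real^'p^'p" and h :: real
    and ls :: "complex list" and r' :: nat
    and U :: "real^'r^'n" and R :: "real^'r^'r"
  assumes "h > 0"
    and "det H \<noteq> 0"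
    and "reachable (disc_A h A) (disc_G h A G)"
    and "observable C (disc_A h A)"
    and "ordered_eigenvalues A ls"
    and "r' = length (filter (\<lambda>\<mu>. Re \<mu> \<ge> 0) ls)"
    and "CARD('r) < CARD('n)"
    and "Re (ls ! (CARD('r) - 1)) > Re (ls ! CARD('r))"
    and "U \<in> U_set A ls"
    and "pd R"
    and "dare (transpose U ** disc_A h A ** U) (transpose U ** disc_G h A G) (C ** U)
              (H ** transpose H) R"
    and "\<forall>R'. pd R' \<and> dare (transpose U ** disc_A h A ** U) (transpose U ** disc_G h A G)
              (C ** U) (H ** transpose H) R' \<longrightarrow> R' = R"
  shows "schur_stable (disc_A h A ** (mat 1 - U ** kalman_gain (C ** U) (H ** transpose H) R ** C))
         \<longleftrightarrow> CARD('r) \<ge> r'"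
proof -
  let ?r = "CARD('r)"
  define Ad where "Ad = disc_A h A"
  define Au where "Au = transpose U ** Ad ** U"
  define F where "F = kalman_gain (C ** U) (H ** transpose H) R"
  define Ac where "Ac = Au ** (mat 1 - F ** (C ** U))"
  define K where "K = Ad ** (mat 1 - U ** F ** C)"
  let ?N = "{y. cmat (transpose U) *v y = 0}"
  have UU: "transpose U ** U = mat 1"
    using assms(9) by (simp add: U_set_def)
  have scaleR_mult: "(h *\<^sub>R X) ** Y = h *\<^sub>R (X ** Y)" "Y' ** (h *\<^sub>R X) = h *\<^sub>R (Y' ** X)"
    for X :: "real^'a^'b" and Y :: "real^'c^'a" and Y' :: "real^'b^'d"
    by (simp_all add: vec_eq_iff matrix_matrix_mult_def sum_distrib_left mult_ac)
  have AdU: "Ad ** U = U ** Au"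
  proof -
    have "(h *\<^sub>R A) ** U = U ** (h *\<^sub>R (transpose U ** A ** U))"
      unfolding scaleR_mult using U_set_intertwine[OF assms(9)] by simp
    \<comment> \<open>The exponential inherits the intertwining with some \<open>B\<close>;
      multiplying by \<open>U^T\<close> identifies \<open>B\<close> as \<open>Au\<close>.\<close>
    then obtain B where B: "Ad ** U = U ** B"
      unfolding Ad_def disc_A_def using mexp_intertwine by blast
    have "Au = transpose U ** U ** B"
      unfolding Au_def matrix_mul_assoc[symmetric] B ..
    then show ?thesis
      using B UU by simp
  qed
  have commute: "A ** Ad = Ad ** A"
    unfolding Ad_def disc_A_def by (rule mexp_intertwine[symmetric]) (simp add: scaleR_mult)
  have Ac_stable: "schur_stable Ac"
    unfolding Ac_def F_def
  proof (rule kalman_closed_loop_schur_stable)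
    show "pd R" "pd (H ** transpose H)"
      using assms(2,10) by (simp_all add: pd_gram_invertible)
    show "dare Au (transpose U ** disc_G h A G) (C ** U) (H ** transpose H) R"
      using assms(11) unfolding Au_def Ad_def .
    \<comment> \<open>Observability passes to the reduced pair: \<open>U y\<close> is an
      unobservable eigenvector of \<open>Ad\<close> or zero, and \<open>U^T U = 1\<close> recovers
      \<open>y\<close>.\<close>
    fix z y assume y: "cmat Au *v y = z *s y" "cmat (C ** U) *v y = 0"
    have "cmat Ad *v (cmat U *v y) = cmat U *v (cmat Au *v y)"
      by (simp only: matrix_vector_mul_assoc cmat_mult[symmetric] AdU)
    then have "cmat Ad *v (cmat U *v y) = z *s (cmat U *v y)"
      by (simp add: y(1) vector_scalar_commute)
    moreover have "cmat C *v (cmat U *v y) = 0"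
      using y(2) by (simp add: cmat_mult matrix_vector_mul_assoc)
    ultimately have "cmat U *v y = 0"
      using observable_no_eigenvector_in_kernel assms(4) unfolding Ad_def by blast
    then have "cmat (transpose U) *v (cmat U *v y) = 0" by simp
    then show "y = 0"
      by (simp add: matrix_vector_mul_assoc cmat_mult[symmetric] UU cmat_mat_1)
  qed
  \<comment> \<open>Transposed form of \<open>K U = U Ac\<close>: \<open>U^T\<close> sends
    eigenvectors of \<open>K^T\<close> outside \<open>?N\<close> to eigenvectors of
    \<open>Ac^T\<close>.\<close>
  have KU: "transpose U ** transpose K = transpose Ac ** transpose U"
  proof -
    have "K ** U = Ad ** U - Ad ** U ** F ** C ** U"
      by (simp add: K_def matrix_diff_ldistrib matrix_diff_rdistrib matrix_mul_assoc)
    also have "\<dots> = U ** Ac"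
      by (simp add: AdU Ac_def matrix_diff_ldistrib matrix_mul_assoc)
    finally show ?thesis
      by (metis matrix_transpose_mul)
  qed
  have N_Ad: "cmat (transpose U) *v (cmat (transpose Ad) *v y) = 0" if "y \<in> ?N" for y
  proof -
    have "transpose U ** transpose Ad = transpose Au ** transpose U"
      by (metis AdU matrix_transpose_mul)
    then have "cmat (transpose U) *v (cmat (transpose Ad) *v y)
        = cmat (transpose Au) *v (cmat (transpose U) *v y)"
      by (simp only: matrix_vector_mul_assoc cmat_mult[symmetric])
    then show ?thesis using that by simp
  qed
  \<comment> \<open>The gain term of \<open>K^T\<close> contains the factor \<open>U^T Ad^T\<close>,
    which vanishes on \<open>?N\<close>.\<close>
  have K_eq_Ad: "cmat (transpose K) *v y = cmat (transpose Ad) *v y" if "y \<in> ?N" for y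
  proof -
    have "transpose K = transpose Ad - transpose C ** transpose F ** (transpose U ** transpose Ad)"
      by (simp add: K_def matrix_diff_ldistrib transpose_diff matrix_transpose_mul matrix_mul_assoc)
    then have "cmat (transpose K) *v y = cmat (transpose Ad) *v y
        - cmat (transpose C ** transpose F) *v (cmat (transpose U) *v (cmat (transpose Ad) *v y))"
      by (simp add: cmat_diff cmat_mult matrix_vector_mult_diff_rdistrib matrix_vector_mul_assoc)
    then show ?thesis using N_Ad[OF that] by simp
  qed
  have N_A: "cmat (transpose A) *v y \<in> ?N" if "y \<in> ?N" for y
  proof -
    have "transpose U ** transpose A = transpose (transpose U ** A ** U) ** transpose U"
      by (metis U_set_intertwine[OF assms(9)] matrix_transpose_mul)
    then have "cmat (transpose U) *v (cmat (transpose A) *v y)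
        = cmat (transpose (transpose U ** A ** U)) *v (cmat (transpose U) *v y)"
      by (simp only: matrix_vector_mul_assoc cmat_mult[symmetric])
    then show ?thesis using that by simp
  qed
  have len: "length ls = CARD('n)" and sorted: "sorted_wrt (\<lambda>a b. Re a \<ge> Re b) ls"
    and cp: "charpoly_at A z = (\<Prod>\<mu>\<leftarrow>ls. z - \<mu>)" for z
    using assms(5) by (auto simp: ordered_eigenvalues_def)
  have eig: "\<mu> \<in> set ls \<longleftrightarrow> (\<exists>x. x \<noteq> 0 \<and> cmat (transpose A) *v x = \<mu> *s x)" for \<mu>
  proof -
    have "\<mu> \<in> set ls \<longleftrightarrow> charpoly_at (transpose A) \<mu> = 0"
      unfolding charpoly_at_transpose cp by (auto simp: prod_list_zero_iff)
    then show ?thesis by (simp add: charpoly_at_eq_0_iff)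
  qed
  have "schur_stable K \<longleftrightarrow> Re (ls ! ?r) < 0"
  proof
    assume K: "schur_stable K"
    \<comment> \<open>Here the spectral gap enters: with indices from zero, \<open>?r - 1\<close> is
      the last of the first \<open>?r\<close> entries, so all of these have larger real part than
      \<open>ls ! ?r\<close>.\<close>
    have "ls ! ?r \<notin> set (take ?r ls)"
    proof
      assume "ls ! ?r \<in> set (take ?r ls)"
      then obtain i where i: "i < ?r" "ls ! ?r = ls ! i"
        by (auto simp: in_set_conv_nth)
      then have "Re (ls ! i) \<ge> Re (ls ! (?r - 1))"
        using sorted_wrt_nth_less[OF sorted, of i "?r - 1"] assms(7) len
        by (cases "i = ?r - 1") auto
      with i(2) assms(8) show False by simp
    qed
    moreover obtain w where w: "w \<noteq> 0" "cmat (transpose A) *v w = (ls ! ?r) *s w"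
      using eig[of "ls ! ?r"] assms(7) len by auto
    ultimately have "w \<in> ?N"
      using left_eigenvector_in_left_kernel_iff[OF assms(9) w(2,1)] by simp
    then have "cmat (transpose K) *v w = exp (of_real h * (ls ! ?r)) *s w"
      using K_eq_Ad left_eigenvector_disc_A[OF w(2)] unfolding Ad_def by simp
    then have "cmod (exp (of_real h * (ls ! ?r))) < 1"
      using K w(1) unfolding schur_stable_iff_left_eigenvectors by blast
    then show "Re (ls ! ?r) < 0"
      using assms(1) by (simp add: mult_less_0_iff)
  next
    assume neg: "Re (ls ! ?r) < 0"
    show "schur_stable K"
      unfolding schur_stable_iff_left_eigenvectors
    proof (intro allI impI, elim conjE)
      fix z and x :: "complex^'n"
      assume x: "x \<noteq> 0" "cmat (transpose K) *v x = z *s x"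
      show "cmod z < 1"
      proof (cases "x \<in> ?N")
        case False
        have "cmat (transpose Ac) *v (cmat (transpose U) *v x)
            = cmat (transpose U) *v (cmat (transpose K) *v x)"
          by (simp only: matrix_vector_mul_assoc cmat_mult[symmetric] KU)
        then have "cmat (transpose Ac) *v (cmat (transpose U) *v x) = z *s (cmat (transpose U) *v x)"
          by (simp add: x(2) vector_scalar_commute)
        then show ?thesis
          using Ac_stable False unfolding schur_stable_iff_left_eigenvectors by blast
      next
        case True
        \<comment> \<open>An eigenvector of \<open>Ad^T\<close> need not be one of
          \<open>A^T\<close>, since distinct eigenvalues of \<open>A\<close> may have equal
          exponentials. But \<open>A^T\<close> commutes with \<open>Ad^T\<close> and preserves this
          part of the eigenspace, so it has an eigenvector \<open>w\<close> inside it.\<close>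
        let ?S = "{y \<in> ?N. cmat (transpose Ad) *v y = z *s y}"
        have "vec.subspace ?S"
          unfolding vec.subspace_def
          by (auto simp: matrix_vector_right_distrib vector_scalar_commute vector_add_ldistrib
              vector_smult_assoc mult.commute)
        moreover have "cmat (transpose A) *v y \<in> ?S" if "y \<in> ?S" for y
        proof -
          have "transpose Ad ** transpose A = transpose A ** transpose Ad"
            by (metis commute matrix_transpose_mul)
          then have "cmat (transpose Ad) *v (cmat (transpose A) *v y)
              = cmat (transpose A) *v (cmat (transpose Ad) *v y)"
            by (simp only: matrix_vector_mul_assoc cmat_mult[symmetric])
          then show ?thesis
            using that N_A[of y] by (simp add: vector_scalar_commute)
        qed
        moreover have "x \<in> ?S"
          using True x(2) K_eq_Ad by simp
        ultimately obtain w \<mu> where w: "w \<in> ?S" "w \<noteq> 0" "cmat (transpose A) *v w = \<mu> *s w"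
          using x(1) by (rule eigenvector_in_invariant_subspace)
        have "\<mu> \<in> set ls" using eig w by blast
        moreover have "\<mu> \<notin> set (take ?r ls)"
          using left_eigenvector_in_left_kernel_iff[OF assms(9) w(3,2)] w(1) by simp
        ultimately have "\<mu> \<in> set (drop ?r ls)"
          by (metis Un_iff append_take_drop_id set_append)
        then obtain i where "i < length ls - ?r" "\<mu> = ls ! (?r + i)"
          by (auto simp: in_set_conv_nth)
        then have "Re \<mu> \<le> Re (ls ! ?r)"
          using sorted_wrt_nth_less[OF sorted, of ?r "?r + i"] by (cases "i = 0") auto
        \<comment> \<open>Both sides are the image of \<open>w\<close> under
          \<open>Ad^T\<close>.\<close>
        moreover have "z *s w = exp (of_real h * \<mu>) *s w"
          using w(1) left_eigenvector_disc_A[OF w(3), of h] unfolding Ad_def by auto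
        then have "z = exp (of_real h * \<mu>)"
          using w(2) by simp
        ultimately show ?thesis
          using neg assms(1) by (simp add: mult_pos_neg)
      qed
    qed
  qed
  also have "\<dots> \<longleftrightarrow> r' \<le> ?r"
    unfolding assms(6) using sorted_count_nonneg_le_iff[OF sorted] assms(7) len by simp
  finally show ?thesis
    unfolding K_def F_def Ad_def .
qed

end
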